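(* For every finite state space $\Omega$, common prior $\mathcal{D}$, pair of initial knowledge partitions, and $f:\Omega\to[0,1]$, and for all $\varepsilon,\delta>0$, the smoothed standard protocol with accuracy parameter $\varepsilon$ causes Alice and Bob to $(\varepsilon,\delta)$-agree after at most $2/(\delta\varepsilon^2)$ messages.
   Context: Smoothed standard protocol with parameter $\varepsilon\in(0,1)$: - Fix a positive integer $b\ge\log_2(200/\varepsilon)$, a number $\epsilon$ that is an integer multiple of $2^{-b}$ with $\varepsilon/50\le\epsilon\le\varepsilon/40$, and set $L=2^b\epsilon$. - For a real number $E$, $\mathrm{round}(E)$ denotes the nearest multiple of $2^{-b}$. - The agents alternate, Alice first. When agent $i$ sends the $(t+1)$-st message, it draws a fresh integer $r\in\{-L,\dots,L\}$ with $\Pr[r=j]=(L-|j|)/L^2$ (triangular distribution), and sends $m_{t+1}=\mathrm{round}(E_{i,t})+2^{-b}r$. Here $E_{i,t}=E_{i,t}(\omega,M_t)$ is agent $i$'s exact Bayesian posterior expectation of $f(\omega)$ under $\mathcal{D}$, given its initial knowledge $\Omega_i(\omega)$ and the message sequence $M_t=(m_1,\dots,m_t)$ so far. The update uses Bayes' rule, taking into account the known randomized rule by which messages are generated. The agents $(\varepsilon,\delta)$-agree after the $t$-th message if $$\Pr_{\omega\sim\mathcal{D},\,M_t}\big[|E_{A,t}(\omega,M_t)-E_{B,t}(\omega,M_t)|>\varepsilon\big]\le\delta,$$ where $M_t$ is generated by the protocol. *)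

theory Defs
  imports "HOL-Probability.Probability"
begin

datatype agent = Alice | Bob

text \<open>The sender of message number \<open>t + 1\<close>.\<close>

definition speaker :: "nat \<Rightarrow> agent" where
  "speaker t = (if even t then Alice else Bob)"

definition cell :: "'w set set \<Rightarrow> 'w \<Rightarrow> 'w set" where
  "cell P \<omega> = (THE X. X \<in> P \<and> \<omega> \<in> X)"

text \<open>Ties are rounded upwards, as for \<^const>\<open>round\<close>.\<close>

definition round_dyadic :: "nat \<Rightarrow> real \<Rightarrow> real" where
  "round_dyadic b x = of_int (round (2 ^ b * x)) / 2 ^ b"

text \<open>Only meaningful for \<open>L > 0\<close>; see \<open>pmf_triangular\<close> below.\<close>

definition triangular_pmf :: "nat \<Rightarrow> int pmf" where
  "triangular_pmf L = embed_pmf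
     (\<lambda>j. if j \<in> {- int L..int L} then (real L - \<bar>real_of_int j\<bar>) / (real L)\<^sup>2 else 0)"

lemma sum_triangular: "(\<Sum>j = - int L..int L. real L - \<bar>real_of_int j\<bar>) = (real L)\<^sup>2"
proof (induction L)
  case 0
  show ?case by simp
next
  case (Suc L)
  have eq: "{- int (Suc L)..int (Suc L)} =
      insert (int (Suc L)) (insert (- int (Suc L)) {- int L..int L})"
    by auto
  have "(\<Sum>j = - int (Suc L)..int (Suc L). real (Suc L) - \<bar>real_of_int j\<bar>) =
      (\<Sum>j = - int L..int L. (real L - \<bar>real_of_int j\<bar>) + 1)"
    unfolding eq by (simp add: algebra_simps)
  also have "\<dots> = (real L)\<^sup>2 + real (card {- int L..int L})"
    by (simp add: sum.distrib Suc.IH del: card_atLeastAtMost_int)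
  also have "\<dots> = (real (Suc L))\<^sup>2"
    by (simp add: power2_eq_square algebra_simps)
  finally show ?case .
qed

lemma pmf_triangular:
  assumes "L > 0"
  shows "pmf (triangular_pmf L) j =
    (if j \<in> {- int L..int L} then (real L - \<bar>real_of_int j\<bar>) / (real L)\<^sup>2 else 0)"
proof -
  let ?g = "\<lambda>j. if j \<in> {- int L..int L} then (real L - \<bar>real_of_int j\<bar>) / (real L)\<^sup>2 else 0"
  have nonneg: "0 \<le> ?g j" for j
    by auto
  have "(\<integral>\<^sup>+ j. ennreal (?g j) \<partial>count_space UNIV) =
      (\<Sum>j = - int L..int L. ennreal (?g j))"
    by (rule nn_integral_count_space'[where A = "{- int L..int L}"]) auto
  also have "\<dots> = ennreal (\<Sum>j = - int L..int L. ?g j)"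
    by (rule sum_ennreal) (rule nonneg)
  also have "(\<Sum>j = - int L..int L. ?g j) =
      (\<Sum>j = - int L..int L. real L - \<bar>real_of_int j\<bar>) / (real L)\<^sup>2"
    by (simp add: sum_divide_distrib)
  also have "\<dots> = 1"
    using assms by (simp add: sum_triangular)
  finally have "(\<integral>\<^sup>+ j. ennreal (?g j) \<partial>count_space UNIV) = 1"
    by simp
  then show ?thesis
    unfolding triangular_pmf_def by (intro pmf_embed_pmf nonneg)
qed

text \<open>
  \<open>K \<omega>\<close> is the law of the message sequence when the true state is \<open>\<omega>\<close>.
\<close>

definition joint_law :: "'w pmf \<Rightarrow> ('w \<Rightarrow> real list pmf) \<Rightarrow> ('w \<times> real list) pmf" where
  "joint_law D K = bind_pmf D (\<lambda>\<omega>. map_pmf (\<lambda>M. (\<omega>, M)) (K \<omega>))"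

text \<open>
  The expectation of \<open>f\<close> given that the state lies in \<open>C\<close> and that the message sequence is \<open>M\<close>.
  The value is unspecified if this event has probability zero.
\<close>

definition posterior ::
  "'w pmf \<Rightarrow> ('w \<Rightarrow> real) \<Rightarrow> ('w \<Rightarrow> real list pmf) \<Rightarrow> 'w set \<Rightarrow> real list \<Rightarrow> real" where
  "posterior D f K C M =
     measure_pmf.expectation (cond_pmf (joint_law D K) (C \<times> {M})) (\<lambda>(\<omega>, M'). f \<omega>)"

text \<open>
  \<open>transcript D f P b L t \<omega>\<close> is the law of \<open>M\<^sub>t\<close> in the state \<open>\<omega>\<close>. Posteriors after \<open>t\<close>
  messages need the laws of \<open>M\<^sub>t\<close> in all states, hence the recursion at function level.
\<close>

primrec transcript ::
  "'w pmf \<Rightarrow> ('w \<Rightarrow> real) \<Rightarrow> (agent \<Rightarrow> 'w set set) \<Rightarrow> nat \<Rightarrow> nat \<Rightarrow> nat \<Rightarrow> 'w \<Rightarrow> real list pmf" where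
  "transcript D f P b L 0 = (\<lambda>\<omega>. return_pmf [])"
| "transcript D f P b L (Suc t) = (\<lambda>\<omega>.
     bind_pmf (transcript D f P b L t \<omega>) (\<lambda>M.
       map_pmf
         (\<lambda>r. M @ [round_dyadic b
                     (posterior D f (transcript D f P b L t) (cell (P (speaker t)) \<omega>) M)
                   + real_of_int r / 2 ^ b])
         (triangular_pmf L)))"

definition agent_expectation ::
  "'w pmf \<Rightarrow> ('w \<Rightarrow> real) \<Rightarrow> (agent \<Rightarrow> 'w set set) \<Rightarrow> nat \<Rightarrow> nat
    \<Rightarrow> agent \<Rightarrow> nat \<Rightarrow> 'w \<Rightarrow> real list \<Rightarrow> real" where
  "agent_expectation D f P b L i t \<omega> M =
     posterior D f (transcript D f P b L t) (cell (P i) \<omega>) M"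

definition agree_after ::
  "'w pmf \<Rightarrow> ('w \<Rightarrow> real) \<Rightarrow> (agent \<Rightarrow> 'w set set) \<Rightarrow> nat \<Rightarrow> nat
    \<Rightarrow> real \<Rightarrow> real \<Rightarrow> nat \<Rightarrow> bool" where
  "agree_after D f P b L \<epsilon> \<delta> t \<longleftrightarrow>
     measure_pmf.prob (joint_law D (transcript D f P b L t))
       {(\<omega>, M). \<bar>agent_expectation D f P b L Alice t \<omega> M
                 - agent_expectation D f P b L Bob t \<omega> M\<bar> > \<epsilon>} \<le> \<delta>"

end

theory Submission
  imports Defs
begin

text \<open>
  Let \<open>c\<^sub>t\<close> be the expectation of \<open>f\<close> given only the first \<open>t\<close> messages; it is a martingale
  with values in \<open>[0, 1]\<close>. The speaker's own message does not change the speaker's expectation, and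
  it lies within \<open>0.0275 \<epsilon>\<close> of it, so after the message \<open>c\<^sub>t\<close> lies within \<open>0.055 \<epsilon>\<close> of the
  expectation of the last speaker. As the agents alternate, \<open>c\<^sub>t\<close> and \<open>c\<^sub>t\<^sub>+\<^sub>1\<close> are close to the two
  agents' expectations after message \<open>t \<ge> 1\<close>, so a disagreement there increases the expectation of
  \<open>c\<^sub>t\<^sup>2\<close> by at least \<open>\<delta> (0.89 \<epsilon>)\<^sup>2\<close>. This cannot happen
  \<open>\<lfloor>2 / (\<delta> \<epsilon>\<^sup>2)\<rfloor>\<close> times, a number that is at least \<open>2\<close> unless \<open>\<epsilon> \<ge> 1\<close> or \<open>\<delta> \<ge> 1\<close>.
\<close>

section \<open>Expectations and conditioning for finitely supported laws\<close>

lemma expectation_cong_set_pmf: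
  fixes u v :: "'a \<Rightarrow> real"
  assumes "\<And>x. x \<in> set_pmf p \<Longrightarrow> u x = v x"
  shows "measure_pmf.expectation p u = measure_pmf.expectation p v"
  using assms by (intro integral_cong_AE) (auto simp: AE_measure_pmf_iff)

lemma expectation_mono_set_pmf:
  fixes u v :: "'a \<Rightarrow> real"
  assumes "finite (set_pmf p)" "\<And>x. x \<in> set_pmf p \<Longrightarrow> u x \<le> v x"
  shows "measure_pmf.expectation p u \<le> measure_pmf.expectation p v"
  using assms
  by (intro integral_mono_AE integrable_measure_pmf_finite) (auto simp: AE_measure_pmf_iff)

lemma expectation_in_interval:
  fixes u :: "'a \<Rightarrow> real"
  assumes "finite (set_pmf p)" "\<And>x. x \<in> set_pmf p \<Longrightarrow> u x \<in> {a..b}"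
  shows "measure_pmf.expectation p u \<in> {a..b}"
  using expectation_mono_set_pmf[of p "\<lambda>_. a" u] expectation_mono_set_pmf[of p u "\<lambda>_. b"] assms
  by simp

text \<open>Agents condition on cells, the averaging argument on fibres of a map; these are only
  known to agree on the support, which suffices.\<close>

lemma cond_pmf_cong:
  assumes "A \<inter> set_pmf p = B \<inter> set_pmf p" "set_pmf p \<inter> A \<noteq> {}"
  shows "cond_pmf p A = cond_pmf p B"
proof (rule pmf_eqI)
  fix x
  have ne: "set_pmf p \<inter> B \<noteq> {}"
    using assms by (simp add: Int_commute)
  have "measure_pmf.prob p A = measure_pmf.prob p B"
    using assms(1) measure_Int_set_pmf[of p A] measure_Int_set_pmf[of p B] by simp
  moreover have "x \<in> A \<longleftrightarrow> x \<in> B" if "pmf p x \<noteq> 0"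
    using assms(1) that[folded set_pmf_iff] by blast
  ultimately show "pmf (cond_pmf p A) x = pmf (cond_pmf p B) x"
    using assms(2) ne by (auto simp: pmf_cond)
qed

text \<open>Leaving \<open>S\<close> free between \<open>set_pmf p \<inter> A\<close> and
  \<open>A\<close> serves two uses: a fibre inside the support, and all states of a cell.\<close>

lemma expectation_cond_pmf:
  fixes F :: "'a \<Rightarrow> real"
  assumes "finite S" "set_pmf p \<inter> A \<subseteq> S" "S \<subseteq> A" "set_pmf p \<inter> A \<noteq> {}"
  shows "measure_pmf.expectation (cond_pmf p A) F = (\<Sum>x\<in>S. F x * pmf p x) / (\<Sum>x\<in>S. pmf p x)"
proof -
  have "measure_pmf.prob p A = measure_pmf.prob p S"
    using assms(2,3) by (intro measure_pmf.finite_measure_eq_AE) (auto simp: AE_measure_pmf_iff)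
  then have pr: "measure_pmf.prob p A = (\<Sum>x\<in>S. pmf p x)"
    using assms(1) by (simp add: measure_measure_pmf_finite)
  have "measure_pmf.expectation (cond_pmf p A) F = (\<Sum>x\<in>S. F x * pmf (cond_pmf p A) x)"
    using assms by (intro integral_measure_pmf_real) (auto simp: set_cond_pmf)
  also have "\<dots> = (\<Sum>x\<in>S. F x * pmf p x / (\<Sum>x\<in>S. pmf p x))"
    using assms(3,4) by (intro sum.cong) (auto simp: pmf_cond pr)
  finally show ?thesis
    by (simp add: sum_divide_distrib)
qed

text \<open>The tower property: on each fibre of \<open>g\<close> the weight \<open>h (g x)\<close>
  is constant, and the conditional mean is a quotient of two sums over that fibre, whose denominator
  cancels.\<close>

lemma expectation_cond_fibre:
  fixes F :: "'a \<Rightarrow> real" and g :: "'a \<Rightarrow> 'b" and h :: "'b \<Rightarrow> real"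
  assumes fin: "finite (set_pmf p)"
  shows "measure_pmf.expectation p
      (\<lambda>x. h (g x) * measure_pmf.expectation (cond_pmf p {y. g y = g x}) F) =
    measure_pmf.expectation p (\<lambda>x. h (g x) * F x)"
proof -
  let ?S = "set_pmf p" and ?c = "\<lambda>k. measure_pmf.expectation (cond_pmf p {y. g y = k}) F"
  have fibre: "(\<Sum>x\<in>{x \<in> ?S. g x = k}. h (g x) * ?c (g x) * pmf p x) =
      (\<Sum>x\<in>{x \<in> ?S. g x = k}. h (g x) * F x * pmf p x)" if "k \<in> g ` ?S" for k
  proof -
    let ?T = "{x \<in> ?S. g x = k}"
    have "?T \<noteq> {}" and finT: "finite ?T"
      using that fin by auto
    then have "(\<Sum>x\<in>?T. pmf p x) > 0"
      by (intro sum_pos) (auto simp: pmf_positive)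
    moreover have "?c k = (\<Sum>x\<in>?T. F x * pmf p x) / (\<Sum>x\<in>?T. pmf p x)"
      using \<open>?T \<noteq> {}\<close> finT by (intro expectation_cond_pmf) auto
    ultimately have "h k * ?c k * (\<Sum>x\<in>?T. pmf p x) = h k * (\<Sum>x\<in>?T. F x * pmf p x)"
      by simp
    then show ?thesis
      by (simp add: sum_distrib_left mult.assoc)
  qed
  have "(\<Sum>x\<in>?S. h (g x) * ?c (g x) * pmf p x) =
      (\<Sum>k\<in>g ` ?S. \<Sum>x\<in>{x \<in> ?S. g x = k}. h (g x) * ?c (g x) * pmf p x)"
    by (rule sum.image_gen[OF fin])
  also have "\<dots> = (\<Sum>k\<in>g ` ?S. \<Sum>x\<in>{x \<in> ?S. g x = k}. h (g x) * F x * pmf p x)"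
    by (rule sum.cong[OF refl fibre])
  also have "\<dots> = (\<Sum>x\<in>?S. h (g x) * F x * pmf p x)"
    by (rule sum.image_gen[OF fin, symmetric])
  finally have "(\<Sum>x\<in>?S. h (g x) * ?c (g x) * pmf p x) = (\<Sum>x\<in>?S. h (g x) * F x * pmf p x)" .
  then show ?thesis
    by (simp add: integral_measure_pmf_real[OF fin])
qed

section \<open>Likelihoods of transcripts and Bayes' formula\<close>

lemma pmf_bind_snoc:
  "pmf (bind_pmf p (\<lambda>M. map_pmf (\<lambda>r. M @ [g M r]) q)) (M @ [m]) =
    pmf p M * pmf (map_pmf (g M) q) m"
proof -
  \<comment> \<open>The list \<open>M @ [m]\<close> determines its prefix, so only
    \<open>M' = M\<close> contributes to the mixture.\<close>
  have *: "pmf (map_pmf (\<lambda>r. M' @ [g M' r]) q) (M @ [m]) =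
      indicator {M} M' * pmf (map_pmf (g M) q) m" for M'
  proof (cases "M' = M")
    case True
    have "map_pmf (\<lambda>r. M @ [g M r]) q = map_pmf (\<lambda>m. M @ [m]) (map_pmf (g M) q)"
      by (simp add: pmf.map_comp o_def)
    moreover have "inj (\<lambda>m. M @ [m])"
      by (rule injI) simp
    ultimately show ?thesis
      using True pmf_map_inj'[of "\<lambda>m. M @ [m]" "map_pmf (g M) q" m] by simp
  next
    case False
    then have "M @ [m] \<notin> set_pmf (map_pmf (\<lambda>r. M' @ [g M' r]) q)"
      by auto
    then show ?thesis
      using False by (simp add: pmf_eq_0_set_pmf del: set_map_pmf)
  qed
  show ?thesis
    by (simp add: pmf_bind * measure_pmf_single)
qed

lemma set_joint_law: "set_pmf (joint_law D K) = {(\<omega>, M). \<omega> \<in> set_pmf D \<and> M \<in> set_pmf (K \<omega>)}"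
  by (auto simp: joint_law_def)

lemma pmf_joint_law: "pmf (joint_law D K) (\<omega>, M) = pmf D \<omega> * pmf (K \<omega>) M"
proof -
  have *: "pmf (map_pmf (Pair \<omega>') (K \<omega>')) (\<omega>, M) = indicator {\<omega>} \<omega>' * pmf (K \<omega>) M" for \<omega>'
  proof (cases "\<omega>' = \<omega>")
    case True
    have "inj (Pair \<omega>)" by (rule injI) simp
    then show ?thesis
      using True pmf_map_inj'[of "Pair \<omega>" "K \<omega>" M] by simp
  next
    case False
    then have "(\<omega>, M) \<notin> set_pmf (map_pmf (Pair \<omega>') (K \<omega>'))"
      by auto
    then show ?thesis
      using False by (simp add: pmf_eq_0_set_pmf del: set_map_pmf)
  qed
  show ?thesis
    by (simp add: joint_law_def pmf_bind * measure_pmf_single)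
qed

text \<open>Bayes' formula with unnormalised weights. The support hypothesis gives the event
  positive probability, without which \<open>posterior\<close> is unspecified; summing over
  \<open>\<Omega> \<inter> C\<close> makes the index set independent of the message law.\<close>

lemma posterior_eq_sum:
  assumes "finite \<Omega>" "set_pmf D \<subseteq> \<Omega>" "(\<omega>, M) \<in> set_pmf (joint_law D K)" "\<omega> \<in> C"
  shows "posterior D f K C M =
    (\<Sum>\<omega>\<in>\<Omega> \<inter> C. f \<omega> * (pmf D \<omega> * pmf (K \<omega>) M)) / (\<Sum>\<omega>\<in>\<Omega> \<inter> C. pmf D \<omega> * pmf (K \<omega>) M)"
proof -
  have "posterior D f K C M =
      (\<Sum>x\<in>(\<Omega> \<inter> C) \<times> {M}. (\<lambda>(\<omega>, M'). f \<omega>) x * pmf (joint_law D K) x) /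
      (\<Sum>x\<in>(\<Omega> \<inter> C) \<times> {M}. pmf (joint_law D K) x)"
    unfolding posterior_def using assms
    by (intro expectation_cond_pmf) (auto simp: set_joint_law)
  moreover have "(\<Omega> \<inter> C) \<times> {M} = (\<lambda>\<omega>. (\<omega>, M)) ` (\<Omega> \<inter> C)"
    by auto
  ultimately show ?thesis
    by (simp add: sum.reindex inj_on_def pmf_joint_law)
qed

lemma posterior_in_interval:
  assumes "finite (set_pmf (joint_law D K))" "\<And>\<omega>. \<omega> \<in> set_pmf D \<Longrightarrow> f \<omega> \<in> {a..b}"
    and "(\<omega>, M) \<in> set_pmf (joint_law D K)" "\<omega> \<in> C"
  shows "posterior D f K C M \<in> {a..b}"
proof -
  have ne: "set_pmf (joint_law D K) \<inter> C \<times> {M} \<noteq> {}"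
    using assms(3,4) by auto
  show ?thesis
    unfolding posterior_def using assms(1,2)
    by (intro expectation_in_interval) (auto simp: set_cond_pmf[OF ne] set_joint_law)
qed

section \<open>Cells of a partition\<close>

lemma cell_mem:
  assumes "partition_on \<Omega> Q" "\<omega> \<in> \<Omega>"
  shows "cell Q \<omega> \<in> Q" "\<omega> \<in> cell Q \<omega>"
proof -
  have "\<exists>!X. X \<in> Q \<and> \<omega> \<in> X"
    using assms(2) partition_onD1[OF assms(1)] partition_onD2[OF assms(1)]
    by (auto simp: disjoint_def)
  from theI'[OF this] show "cell Q \<omega> \<in> Q" "\<omega> \<in> cell Q \<omega>"
    by (auto simp: cell_def)
qed

lemma cell_eq_iff:
  assumes "partition_on \<Omega> Q" "\<omega> \<in> \<Omega>" "\<omega>' \<in> \<Omega>"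
  shows "cell Q \<omega>' = cell Q \<omega> \<longleftrightarrow> \<omega>' \<in> cell Q \<omega>"
  using cell_mem[OF assms(1,2)] cell_mem[OF assms(1,3)] partition_onD2[OF assms(1)]
  by (auto simp: disjoint_def)

section \<open>The protocol: messages and their senders' expectations\<close>

locale smoothed_protocol =
  fixes \<Omega> :: "'w set" and D :: "'w pmf" and P :: "agent \<Rightarrow> 'w set set" and f :: "'w \<Rightarrow> real"
    and b L :: nat
  assumes finite_states: "finite \<Omega>" and support: "set_pmf D \<subseteq> \<Omega>"
    and partition: "\<And>i. partition_on \<Omega> (P i)"
    and f_unit: "\<And>\<omega>. \<omega> \<in> \<Omega> \<Longrightarrow> f \<omega> \<in> {0..1}"
    and L_pos: "L > 0"
begin

abbreviation law :: "nat \<Rightarrow> ('w \<times> real list) pmf" where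
  "law t \<equiv> joint_law D (transcript D f P b L t)"

abbreviation expect :: "agent \<Rightarrow> nat \<Rightarrow> 'w \<Rightarrow> real list \<Rightarrow> real" where
  "expect \<equiv> agent_expectation D f P b L"

text \<open>The martingale \<open>c\<^sub>t\<close>, as the belief of an outside observer: the cell
  \<open>UNIV\<close> stands for having no private knowledge.\<close>

definition public :: "nat \<Rightarrow> real list \<Rightarrow> real" where
  "public t M = posterior D f (transcript D f P b L t) UNIV M"

definition potential :: "nat \<Rightarrow> real" where
  "potential t = measure_pmf.expectation (law t) (\<lambda>(\<omega>, M). (public t M)\<^sup>2)"

text \<open>Twice the largest distance between a message and its sender's expectation.\<close>

definition radius :: real where
  "radius = (2 * real L + 1) / 2 ^ b"

lemma set_triangular: "set_pmf (triangular_pmf L) \<subseteq> {- int L..int L}"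
  using L_pos by (auto simp: set_pmf_iff pmf_triangular split: if_splits)

lemma finite_transcript: "finite (set_pmf (transcript D f P b L t \<omega>))"
proof (induction t)
  case (Suc t)
  then show ?case
    using finite_subset[OF set_triangular] by simp
qed simp

lemma finite_law: "finite (set_pmf (law t))"
proof -
  have "set_pmf (law t) = (SIGMA \<omega>:set_pmf D. set_pmf (transcript D f P b L t \<omega>))"
    by (auto simp: set_joint_law)
  then show ?thesis
    using finite_subset[OF support finite_states] by (simp add: finite_transcript)
qed

lemma law_state: "(\<omega>, M) \<in> set_pmf (law t) \<Longrightarrow> \<omega> \<in> \<Omega>"
  using support by (auto simp: set_joint_law)

lemma expect_unit:
  assumes "(\<omega>, M) \<in> set_pmf (law t)"
  shows "expect i t \<omega> M \<in> {0..1}"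
  unfolding agent_expectation_def
  using assms f_unit support law_state[OF assms] cell_mem[OF partition]
  by (intro posterior_in_interval[OF finite_law]) auto

lemma public_unit:
  assumes "(\<omega>, M) \<in> set_pmf (law t)"
  shows "public t M \<in> {0..1}"
  unfolding public_def
  using assms f_unit support
  by (intro posterior_in_interval[OF finite_law]) auto

lemma law_Suc_cases:
  assumes "(\<omega>, M') \<in> set_pmf (law (Suc t))"
  obtains M m where "M' = M @ [m]" "(\<omega>, M) \<in> set_pmf (law t)"
    "\<bar>expect (speaker t) t \<omega> M - m\<bar> \<le> radius / 2"
proof -
  from assms obtain M r where M: "M \<in> set_pmf (transcript D f P b L t \<omega>)" "\<omega> \<in> set_pmf D"
    and r: "r \<in> set_pmf (triangular_pmf L)"
    and M': "M' = M @ [round_dyadic b (expect (speaker t) t \<omega> M) + real_of_int r / 2 ^ b]"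
    by (auto simp: set_joint_law agent_expectation_def)
  \<comment> \<open>In units of \<open>1 / 2 ^ b\<close>, rounding moves the value by at most
    \<open>1 / 2\<close> and the noise by at most \<open>L\<close>.\<close>
  define x where "x = 2 ^ b * expect (speaker t) t \<omega> M"
  have "\<bar>r\<bar> \<le> int L"
    using r set_triangular by fastforce
  then have "\<bar>real_of_int r\<bar> \<le> real L"
    by linarith
  moreover have "\<bar>of_int (round x) - x\<bar> \<le> 1 / 2"
    by (rule of_int_round_abs_le)
  moreover have "\<bar>x - (of_int (round x) + of_int r)\<bar> \<le>
      \<bar>of_int (round x) - x\<bar> + \<bar>real_of_int r\<bar>"
    by (simp add: abs_if)
  ultimately have "\<bar>x - (of_int (round x) + of_int r)\<bar> \<le> (2 * real L + 1) / 2"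
    unfolding add_divide_distrib by simp
  then have "\<bar>x - (of_int (round x) + of_int r)\<bar> / 2 ^ b \<le> radius / 2"
    by (simp add: radius_def divide_simps)
  moreover have "\<bar>x - (of_int (round x) + of_int r)\<bar> / 2 ^ b =
      \<bar>(x - (of_int (round x) + of_int r)) / 2 ^ b\<bar>"
    by (simp add: abs_divide)
  moreover have "(x - (of_int (round x) + of_int r)) / 2 ^ b =
      expect (speaker t) t \<omega> M -
        (round_dyadic b (expect (speaker t) t \<omega> M) + real_of_int r / 2 ^ b)"
    by (simp add: x_def round_dyadic_def diff_divide_distrib add_divide_distrib)
  ultimately show ?thesis
    using M M' that by (auto simp: set_joint_law)
qed

text \<open>The noise is independent of the state, so given the speaker's information the new message
  multiplies all likelihoods by the same factor.\<close>

lemma expect_speaker_Suc: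
  assumes "(\<omega>, M @ [m]) \<in> set_pmf (law (Suc t))"
  shows "expect (speaker t) (Suc t) \<omega> (M @ [m]) = expect (speaker t) t \<omega> M"
proof -
  let ?C = "cell (P (speaker t)) \<omega>"
  let ?tr = "transcript D f P b L"
  \<comment> \<open>The probability that the speaker, having seen \<open>M\<close>, sends
    \<open>m\<close>; it depends on the state only through the cell, hence is the same on all of
    \<open>\<Omega> \<inter> ?C\<close>.\<close>
  define q where "q = pmf (map_pmf (\<lambda>r. round_dyadic b (posterior D f (?tr t) ?C M)
    + real_of_int r / 2 ^ b) (triangular_pmf L)) m"
  have \<omega>: "\<omega> \<in> \<Omega>"
    using law_state[OF assms] .
  have memC: "\<omega> \<in> ?C"
    using cell_mem[OF partition \<omega>] by simp
  have inM: "(\<omega>, M) \<in> set_pmf (law t)"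
    using assms by (rule law_Suc_cases) auto
  have lik: "pmf (?tr (Suc t) \<omega>') (M @ [m]) = pmf (?tr t \<omega>') M * q" if "\<omega>' \<in> \<Omega> \<inter> ?C" for \<omega>'
  proof -
    have "cell (P (speaker t)) \<omega>' = ?C"
      using cell_eq_iff[OF partition \<omega>] that by auto
    then show ?thesis
      by (simp add: pmf_bind_snoc q_def)
  qed
  \<comment> \<open>The observed transcript has positive probability, so its factor \<open>q\<close>
    can be cancelled.\<close>
  have "q \<noteq> 0"
    using lik[of \<omega>] \<omega> memC assms by (auto simp: set_joint_law set_pmf_iff simp del: transcript.simps)
  have "expect (speaker t) (Suc t) \<omega> (M @ [m]) =
      (\<Sum>\<omega>'\<in>\<Omega> \<inter> ?C. f \<omega>' * (pmf D \<omega>' * pmf (?tr (Suc t) \<omega>') (M @ [m]))) /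
      (\<Sum>\<omega>'\<in>\<Omega> \<inter> ?C. pmf D \<omega>' * pmf (?tr (Suc t) \<omega>') (M @ [m]))"
    unfolding agent_expectation_def by (rule posterior_eq_sum[OF finite_states support assms memC])
  also have "\<dots> = (\<Sum>\<omega>'\<in>\<Omega> \<inter> ?C. f \<omega>' * (pmf D \<omega>' * pmf (?tr t \<omega>') M) * q) /
      (\<Sum>\<omega>'\<in>\<Omega> \<inter> ?C. pmf D \<omega>' * pmf (?tr t \<omega>') M * q)"
    by (intro arg_cong2[where f = "(/)"] sum.cong refl) (simp_all only: lik mult_ac)
  also have "\<dots> = (\<Sum>\<omega>'\<in>\<Omega> \<inter> ?C. f \<omega>' * (pmf D \<omega>' * pmf (?tr t \<omega>') M)) /
      (\<Sum>\<omega>'\<in>\<Omega> \<inter> ?C. pmf D \<omega>' * pmf (?tr t \<omega>') M)"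
    using \<open>q \<noteq> 0\<close> by (simp add: sum_distrib_right[symmetric])
  also have "\<dots> = expect (speaker t) t \<omega> M"
    unfolding agent_expectation_def
    by (rule posterior_eq_sum[OF finite_states support inM memC, symmetric])
  finally show ?thesis .
qed

section \<open>The public expectation as an average of an agent's expectations\<close>

lemma expectation_public:
  "measure_pmf.expectation (law t) (\<lambda>(\<omega>, M). h M * public t M) =
    measure_pmf.expectation (law t) (\<lambda>(\<omega>, M). h M * f \<omega>)"
proof -
  have fibre: "{y. snd y = M} = UNIV \<times> {M}" for M :: "real list"
    by auto
  show ?thesis
    using expectation_cond_fibre[OF finite_law[of t], of h snd "\<lambda>(\<omega>, M). f \<omega>"]
    by (simp add: public_def posterior_def fibre case_prod_unfold)
qed

text \<open>Tower property for the pair of cell and transcript, as \<open>h\<close> sees only the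
  transcript. With \<open>expectation_public\<close>, the public and any agent's expectation have
  equal integrals against functions of the transcript.\<close>

lemma expectation_expect:
  "measure_pmf.expectation (law t) (\<lambda>(\<omega>, M). h M * expect i t \<omega> M) =
    measure_pmf.expectation (law t) (\<lambda>(\<omega>, M). h M * f \<omega>)"
proof -
  let ?g = "\<lambda>(\<omega>, M). (cell (P i) \<omega>, M)"
  have "expect i t \<omega> M =
      measure_pmf.expectation (cond_pmf (law t) {y. ?g y = ?g (\<omega>, M)}) (\<lambda>(\<omega>, M). f \<omega>)"
    if "(\<omega>, M) \<in> set_pmf (law t)" for \<omega> M
  proof -
    note \<omega> = law_state[OF that]
    have "cond_pmf (law t) (cell (P i) \<omega> \<times> {M}) = cond_pmf (law t) {y. ?g y = ?g (\<omega>, M)}"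
    \<comment> \<open>Outside \<open>\<Omega>\<close> the value of \<open>cell\<close> is
      unspecified, so the fibre may contain further points, all of probability zero.\<close>
    proof (rule cond_pmf_cong)
      show "cell (P i) \<omega> \<times> {M} \<inter> set_pmf (law t) = {y. ?g y = ?g (\<omega>, M)} \<inter> set_pmf (law t)"
        using cell_eq_iff[OF partition \<omega> law_state] by fastforce
      show "set_pmf (law t) \<inter> cell (P i) \<omega> \<times> {M} \<noteq> {}"
        using that cell_mem[OF partition \<omega>] by auto
    qed
    then show ?thesis
      by (simp add: agent_expectation_def posterior_def)
  qed
  then have "measure_pmf.expectation (law t) (\<lambda>(\<omega>, M). h M * expect i t \<omega> M) =
      measure_pmf.expectation (law t) (\<lambda>x. (\<lambda>(C, M). h M) (?g x) *
        measure_pmf.expectation (cond_pmf (law t) {y. ?g y = ?g x}) (\<lambda>(\<omega>, M). f \<omega>))"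
    by (intro expectation_cong_set_pmf) auto
  also have "\<dots> = measure_pmf.expectation (law t)
      (\<lambda>x. (\<lambda>(C, M). h M) (?g x) * (\<lambda>(\<omega>, M). f \<omega>) x)"
    by (rule expectation_cond_fibre[OF finite_law])
  finally show ?thesis
    by (simp add: case_prod_unfold)
qed

text \<open>Given the transcript, \<open>public\<close> averages the last speaker's expectation over
  the possible states. That expectation is unchanged by the speaker's own message \<open>m\<close>,
  hence within \<open>radius / 2\<close> of \<open>m\<close> in each of these states, and so is the
  average.\<close>

lemma public_close_to_message:
  assumes "(\<omega>, M @ [m]) \<in> set_pmf (law (Suc t))"
  shows "\<bar>public (Suc t) (M @ [m]) - m\<bar> \<le> radius / 2"
proof -
  let ?h = "indicat_real {M @ [m]}"
  let ?E = "measure_pmf.expectation (law (Suc t))"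
  let ?i = "speaker t"
  \<comment> \<open>Testing against the indicator of one transcript turns equality of integrals into
    a statement about that transcript; \<open>w\<close> is its probability.\<close>
  define w where "w = ?E (\<lambda>(\<omega>, M'). ?h M')"
  have ind: "(\<lambda>(\<omega>, M'). ?h M') = indicat_real (UNIV \<times> {M @ [m]})"
    by (auto simp: fun_eq_iff indicator_def)
  have "w = measure_pmf.prob (law (Suc t)) (UNIV \<times> {M @ [m]})"
    unfolding w_def ind by simp
  also have "\<dots> > 0"
    using assms by (intro measure_pmf_posI) auto
  finally have "w > 0" .
  have scale: "?E (\<lambda>x. a * (\<lambda>(\<omega>, M'). ?h M') x) = a * w" for a
    unfolding w_def by (rule integral_mult_right_zero)
  have eq: "public (Suc t) (M @ [m]) * w = ?E (\<lambda>(\<omega>, M'). ?h M' * expect ?i (Suc t) \<omega> M')"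
  proof -
    have "public (Suc t) (M @ [m]) * w = ?E (\<lambda>x. public (Suc t) (M @ [m]) * (\<lambda>(\<omega>, M'). ?h M') x)"
      by (rule scale[symmetric])
    also have "\<dots> = ?E (\<lambda>(\<omega>, M'). ?h M' * public (Suc t) M')"
      by (intro expectation_cong_set_pmf) (auto simp: indicator_def)
    also have "\<dots> = ?E (\<lambda>(\<omega>, M'). ?h M' * expect ?i (Suc t) \<omega> M')"
      by (simp only: expectation_public expectation_expect)
    finally show ?thesis .
  qed
  have close: "\<bar>expect ?i (Suc t) \<omega>' (M @ [m]) - m\<bar> \<le> radius / 2"
    if "(\<omega>', M @ [m]) \<in> set_pmf (law (Suc t))" for \<omega>'
    unfolding expect_speaker_Suc[OF that] using that by (rule law_Suc_cases) simp
  have lower: "?E (\<lambda>x. (m - radius / 2) * (\<lambda>(\<omega>, M'). ?h M') x) \<le>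
      ?E (\<lambda>(\<omega>, M'). ?h M' * expect ?i (Suc t) \<omega> M')"
  proof (intro expectation_mono_set_pmf[OF finite_law], clarsimp simp del: transcript.simps)
    fix \<omega>' M' assume "(\<omega>', M') \<in> set_pmf (law (Suc t))"
    then show "(m - radius / 2) * ?h M' \<le> ?h M' * expect ?i (Suc t) \<omega>' M'"
      using close[of \<omega>']
      by (cases "M' = M @ [m]") (auto simp: abs_if split: if_splits simp del: transcript.simps)
  qed
  have upper: "?E (\<lambda>(\<omega>, M'). ?h M' * expect ?i (Suc t) \<omega> M') \<le>
      ?E (\<lambda>x. (m + radius / 2) * (\<lambda>(\<omega>, M'). ?h M') x)"
  proof (intro expectation_mono_set_pmf[OF finite_law], clarsimp simp del: transcript.simps)
    fix \<omega>' M' assume "(\<omega>', M') \<in> set_pmf (law (Suc t))"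
    then show "?h M' * expect ?i (Suc t) \<omega>' M' \<le> (m + radius / 2) * ?h M'"
      using close[of \<omega>']
      by (cases "M' = M @ [m]") (auto simp: abs_if split: if_splits simp del: transcript.simps)
  qed
  have "(m - radius / 2) * w \<le> public (Suc t) (M @ [m]) * w"
    using lower unfolding eq scale .
  moreover have "public (Suc t) (M @ [m]) * w \<le> (m + radius / 2) * w"
    using upper unfolding eq scale .
  ultimately show ?thesis
    using \<open>w > 0\<close> by (auto simp: abs_if)
qed

text \<open>The message lies within \<open>radius / 2\<close> of both sides. The first form serves
  the agent who spoke just before a disagreement, the second the one who speaks just after
  it.\<close>

lemma public_close_to_speaker:
  assumes "(\<omega>, M) \<in> set_pmf (law (Suc t))"
  shows "\<bar>public (Suc t) M - expect (speaker t) (Suc t) \<omega> M\<bar> \<le> radius"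
    and "\<bar>public (Suc t) M - expect (speaker t) t \<omega> (butlast M)\<bar> \<le> radius"
proof -
  obtain M' m where M: "M = M' @ [m]" and le: "\<bar>expect (speaker t) t \<omega> M' - m\<bar> \<le> radius / 2"
    using assms by (rule law_Suc_cases)
  have "\<bar>public (Suc t) M - m\<bar> \<le> radius / 2"
    using assms unfolding M by (rule public_close_to_message)
  moreover have "expect (speaker t) (Suc t) \<omega> M = expect (speaker t) t \<omega> M'"
    using assms unfolding M by (rule expect_speaker_Suc)
  ultimately show "\<bar>public (Suc t) M - expect (speaker t) (Suc t) \<omega> M\<bar> \<le> radius"
    and "\<bar>public (Suc t) M - expect (speaker t) t \<omega> (butlast M)\<bar> \<le> radius"
    using le unfolding M butlast_snoc by linarith+
qed

section \<open>The martingale and its potential\<close>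

lemma law_butlast: "map_pmf (\<lambda>(\<omega>, M). (\<omega>, butlast M)) (law (Suc t)) = law t"
proof -
  have "map_pmf butlast (transcript D f P b L (Suc t) \<omega>) = transcript D f P b L t \<omega>" for \<omega>
    by (simp add: map_bind_pmf pmf.map_comp o_def bind_return_pmf')
  \<comment> \<open>The flipped composition rule splits \<open>Pair\<close> after
    \<open>butlast\<close> into two maps, so that the consistency of the transcripts
    applies.\<close>
  then show ?thesis
    unfolding joint_law_def
    by (simp add: map_bind_pmf pmf.map_comp o_def
        flip: pmf.map_comp[unfolded o_def, of "Pair _" butlast] del: transcript.simps)
qed

text \<open>Brings quantities of consecutive times under the single law
  \<open>law (Suc t)\<close>.\<close>

lemma expectation_law_butlast:
  fixes u :: "'w \<Rightarrow> real list \<Rightarrow> real"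
  shows "measure_pmf.expectation (law (Suc t)) (\<lambda>(\<omega>, M). u \<omega> (butlast M)) =
    measure_pmf.expectation (law t) (\<lambda>(\<omega>, M). u \<omega> M)"
  unfolding law_butlast[of t, symmetric] by (simp add: case_prod_unfold)

text \<open>Orthogonality of martingale increments: the mixed term \<open>?Y\<close> and the square
  \<open>?Z\<close> both have expectation \<open>potential t\<close>, so expanding the square leaves
  the difference.\<close>

lemma potential_Suc:
  "potential (Suc t) - potential t =
    measure_pmf.expectation (law (Suc t)) (\<lambda>(\<omega>, M). (public (Suc t) M - public t (butlast M))\<^sup>2)"
proof -
  let ?E = "measure_pmf.expectation (law (Suc t))"
  let ?X = "\<lambda>(\<omega> :: 'w, M). (public (Suc t) M)\<^sup>2"
  let ?Y = "\<lambda>(\<omega> :: 'w, M). public t (butlast M) * public (Suc t) M"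
  let ?Z = "\<lambda>(\<omega> :: 'w, M). (public t (butlast M))\<^sup>2"
  \<comment> \<open>The factor \<open>public t (butlast M)\<close> is a function of the longer
    transcript, so averaging replaces \<open>public (Suc t) M\<close> by \<open>f\<close>.\<close>
  have "?E ?Y = ?E (\<lambda>(\<omega>, M). public t (butlast M) * f \<omega>)"
    by (rule expectation_public)
  also have "\<dots> = measure_pmf.expectation (law t) (\<lambda>(\<omega>, M). public t M * f \<omega>)"
    by (rule expectation_law_butlast)
  also have "\<dots> = potential t"
    by (simp add: potential_def power2_eq_square expectation_public)
  finally have Y: "?E ?Y = potential t" .
  have Z: "?E ?Z = potential t"
    unfolding potential_def by (rule expectation_law_butlast)
  have "?E (\<lambda>(\<omega>, M). (public (Suc t) M - public t (butlast M))\<^sup>2) =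
      ?E (\<lambda>x. ?X x - 2 * ?Y x + ?Z x)"
    by (intro arg_cong[where f = ?E]) (auto simp: fun_eq_iff power2_eq_square algebra_simps)
  also have "\<dots> = ?E ?X - 2 * ?E ?Y + ?E ?Z"
    by (simp add: integrable_measure_pmf_finite[OF finite_law] del: transcript.simps)
  finally show ?thesis
    unfolding Y Z by (simp add: potential_def)
qed

lemma potential_unit: "potential t \<in> {0..1}"
proof -
  have "(\<lambda>(\<omega>, M). (public t M)\<^sup>2) x \<in> {0..1}" if "x \<in> set_pmf (law t)" for x
    using that public_unit[of "fst x" "snd x" t] by (simp add: case_prod_unfold power_le_one)
  then show ?thesis
    unfolding potential_def by (rule expectation_in_interval[OF finite_law])
qed

text \<open>The sender of message \<open>t + 1\<close> has an expectation near
  \<open>public (Suc t)\<close>; the other agent speaks next, which brings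
  \<open>public (Suc (Suc t))\<close> near that agent's earlier expectation. A disagreement thus
  forces a jump of at least \<open>\<epsilon> - 2 * radius\<close>. One message must have been sent
  already, hence \<open>Suc t\<close>.\<close>

lemma potential_gain:
  assumes "\<not> agree_after D f P b L \<epsilon> \<delta> (Suc t)" and "2 * radius \<le> \<epsilon>"
  shows "potential (Suc (Suc t)) - potential (Suc t) \<ge> \<delta> * (\<epsilon> - 2 * radius)\<^sup>2"
proof -
  let ?s = "Suc t" and ?a = "(\<epsilon> - 2 * radius)\<^sup>2"
  let ?bad = "\<lambda>\<omega> M. \<bar>expect Alice (Suc t) \<omega> M - expect Bob (Suc t) \<omega> M\<bar> > \<epsilon>"
  have gap: "(public (Suc ?s) M - public ?s (butlast M))\<^sup>2 \<ge> ?a"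
    if M: "(\<omega>, M) \<in> set_pmf (law (Suc ?s))" and bad: "?bad \<omega> (butlast M)" for \<omega> M
  proof -
    have "(\<omega>, butlast M) \<in> set_pmf (law ?s)"
      using M by (rule law_Suc_cases) auto
    then have "\<bar>public ?s (butlast M) - expect (speaker t) ?s \<omega> (butlast M)\<bar> \<le> radius"
      by (rule public_close_to_speaker)
    moreover have "\<bar>public (Suc ?s) M - expect (speaker ?s) ?s \<omega> (butlast M)\<bar> \<le> radius"
      using M by (rule public_close_to_speaker)
    \<comment> \<open>Consecutive speakers are Alice and Bob in one order or the other.\<close>
    moreover have "\<bar>expect (speaker t) ?s \<omega> (butlast M) - expect (speaker ?s) ?s \<omega> (butlast M)\<bar> > \<epsilon>"
      using bad by (cases "even t") (simp_all add: speaker_def abs_minus_commute)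
    ultimately have "\<bar>\<epsilon> - 2 * radius\<bar> \<le> \<bar>public (Suc ?s) M - public ?s (butlast M)\<bar>"
      using assms(2) by linarith
    then show ?thesis
      by (simp add: abs_le_square_iff)
  qed
  have ind: "indicat_real {(\<omega>, M). ?bad \<omega> M} = (\<lambda>(\<omega>, M). of_bool (?bad \<omega> M))"
    by (auto simp: fun_eq_iff indicator_def)
  have "\<delta> \<le> measure_pmf.prob (law ?s) {(\<omega>, M). ?bad \<omega> M}"
    using assms(1) by (simp add: agree_after_def)
  then have "\<delta> * ?a \<le> measure_pmf.prob (law ?s) {(\<omega>, M). ?bad \<omega> M} * ?a"
    by (intro mult_right_mono) auto
  also have "measure_pmf.prob (law ?s) {(\<omega>, M). ?bad \<omega> M} =
      measure_pmf.expectation (law ?s) (indicat_real {(\<omega>, M). ?bad \<omega> M})"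
    by simp
  also have "\<dots> = measure_pmf.expectation (law (Suc ?s)) (\<lambda>(\<omega>, M). of_bool (?bad \<omega> (butlast M)))"
    unfolding ind by (rule expectation_law_butlast[symmetric])
  also have "\<dots> * ?a = measure_pmf.expectation (law (Suc ?s))
      (\<lambda>x. (\<lambda>(\<omega>, M). of_bool (?bad \<omega> (butlast M))) x * ?a)"
    by (rule integral_mult_left_zero[symmetric])
  also have "\<dots> \<le> measure_pmf.expectation (law (Suc ?s))
      (\<lambda>(\<omega>, M). (public (Suc ?s) M - public ?s (butlast M))\<^sup>2)"
    using gap by (intro expectation_mono_set_pmf[OF finite_law]) auto
  also have "\<dots> = potential (Suc ?s) - potential ?s"
    by (rule potential_Suc[symmetric])
  finally show ?thesis .
qed

text \<open>The gains telescope within the unit interval, starting at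
  \<open>potential (Suc 0)\<close> because a gain needs a message already sent.\<close>

lemma disagreement_bound:
  assumes "\<And>t. t \<in> {1..T} \<Longrightarrow> \<not> agree_after D f P b L \<epsilon> \<delta> t" and "2 * radius \<le> \<epsilon>"
  shows "real T * (\<delta> * (\<epsilon> - 2 * radius)\<^sup>2) \<le> 1"
proof -
  have "n \<le> T \<Longrightarrow> real n * (\<delta> * (\<epsilon> - 2 * radius)\<^sup>2) \<le> potential (Suc n) - potential (Suc 0)" for n
  proof (induction n)
    case (Suc n)
    then have "\<not> agree_after D f P b L \<epsilon> \<delta> (Suc n)"
      by (intro assms(1)) auto
    from potential_gain[OF this assms(2)] show ?case
      using Suc by (simp add: distrib_right)
  qed simp
  from this[of T] show ?thesis
    using potential_unit[of "Suc T"] potential_unit[of "Suc 0"] by simp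
qed

end

section \<open>Numerical constants and the number of messages\<close>

theorem theorem10:
  fixes \<Omega> :: "'w set" and D :: "'w pmf" and P :: "agent \<Rightarrow> 'w set set" and f :: "'w \<Rightarrow> real"
    and \<epsilon> \<delta> \<eta> :: real and b L :: nat
  assumes "finite \<Omega>" and "set_pmf D \<subseteq> \<Omega>"
    and "\<And>i. partition_on \<Omega> (P i)"
    and "\<And>\<omega>. \<omega> \<in> \<Omega> \<Longrightarrow> f \<omega> \<in> {0..1}"
    and "\<epsilon> > 0" and "\<delta> > 0"
    and "b > 0" and "real b \<ge> log 2 (200 / \<epsilon>)"
    and "\<epsilon> / 50 \<le> \<eta>" and "\<eta> \<le> \<epsilon> / 40"
    and "real L = 2 ^ b * \<eta>"
  shows "\<exists>t::nat. real t \<le> 2 / (\<delta> * \<epsilon>\<^sup>2) \<and> agree_after D f P b L \<epsilon> \<delta> t"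
proof -
  have "\<eta> > 0"
    using assms(5,9) by linarith
  then have "real L > 0"
    using assms(11) by simp
  then interpret smoothed_protocol \<Omega> D P f b L
    using assms(1-4) by unfold_locales auto
  have "200 / \<epsilon> \<le> 2 powr real b"
    using assms(5,8) by (simp add: log_le_iff)
  then have "1 / 2 ^ b \<le> \<epsilon> / 200"
    using assms(5) by (simp add: powr_realpow divide_simps mult.commute)
  moreover have "radius = 2 * \<eta> + 1 / 2 ^ b"
    using assms(11) by (simp add: radius_def field_simps)
  \<comment> \<open>Here \<open>2 * radius = 4 * \<eta> + 2 / 2 ^ b\<close>, with
    \<open>4 * \<eta> \<le> \<epsilon> / 10\<close> and
    \<open>2 / 2 ^ b \<le> \<epsilon> / 100\<close>.\<close>
  ultimately have radius: "2 * radius \<le> 11 / 100 * \<epsilon>"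
    using assms(10) by simp
  show ?thesis
  proof (cases "\<epsilon> < 1 \<and> \<delta> < 1")
    \<comment> \<open>Expectations in the unit interval differ by at most \<open>1\<close>, and
      probabilities are at most \<open>1\<close>, so the agents agree before any message.\<close>
    case False
    have "agree_after D f P b L \<epsilon> \<delta> 0"
    proof (cases "\<delta> \<ge> 1")
      case True
      then show ?thesis
        unfolding agree_after_def using measure_pmf.prob_le_1 order_trans by blast
    next
      case small: False
      have "\<not> \<bar>expect Alice 0 \<omega> M - expect Bob 0 \<omega> M\<bar> > \<epsilon>" if "(\<omega>, M) \<in> set_pmf (law 0)" for \<omega> M
        using expect_unit[OF that, of Alice] expect_unit[OF that, of Bob] False small by auto
      then have "measure_pmf.prob (law 0)
          {(\<omega>, M). \<bar>expect Alice 0 \<omega> M - expect Bob 0 \<omega> M\<bar> > \<epsilon>} = 0"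
        by (subst measure_pmf_zero_iff) auto
      then show ?thesis
        using assms(6) by (simp add: agree_after_def)
    qed
    then show ?thesis
      using assms(5,6) by (intro exI[of _ 0]) simp
  next
    case True
    define x where "x = \<delta> * \<epsilon>\<^sup>2"
    have "\<epsilon>\<^sup>2 \<le> 1"
      using True assms(5) by (simp add: power_le_one)
    then have x: "0 < x" "x \<le> 1"
      using True assms(5,6) by (auto simp: x_def mult_le_one)
    define T where "T = nat \<lfloor>2 / x\<rfloor>"
    \<comment> \<open>The bound \<open>T \<ge> 2\<close> matters: \<open>T \<ge> 1\<close> would
      only yield \<open>T * x > 1\<close>, too weak for the factor \<open>7921 / 10000\<close>
      below.\<close>
    have "2 / x \<ge> 2"
      using x by (simp add: field_simps)
    then have "\<lfloor>2 / x\<rfloor> \<ge> 2"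
      by (simp add: le_floor_iff)
    then have "int T = \<lfloor>2 / x\<rfloor>"
      unfolding T_def by linarith
    then have "real T = of_int \<lfloor>2 / x\<rfloor>"
      by (metis of_int_of_nat_eq)
    then have T: "real T \<le> 2 / x" "2 / x < real T + 1" "real T \<ge> 2"
      using \<open>\<lfloor>2 / x\<rfloor> \<ge> 2\<close> by linarith+
    show ?thesis
    proof (rule ccontr)
      assume none: "\<not> ?thesis"
      have "\<not> agree_after D f P b L \<epsilon> \<delta> t" if "t \<in> {1..T}" for t
      proof -
        have "real t \<le> 2 / (\<delta> * \<epsilon>\<^sup>2)"
          using that T(1) unfolding x_def by (meson atLeastAtMost_iff of_nat_mono order_trans)
        then show ?thesis
          using none by blast
      qed
      then have "real T * (\<delta> * (\<epsilon> - 2 * radius)\<^sup>2) \<le> 1"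
        using radius assms(5) by (intro disagreement_bound) auto
      moreover have "(89 / 100 * \<epsilon>)\<^sup>2 \<le> (\<epsilon> - 2 * radius)\<^sup>2"
        using radius assms(5) by (intro power_mono) auto
      then have "real T * (\<delta> * (89 / 100 * \<epsilon>)\<^sup>2) \<le> real T * (\<delta> * (\<epsilon> - 2 * radius)\<^sup>2)"
        using assms(6) by (intro mult_left_mono) auto
      moreover have "real T * (\<delta> * (89 / 100 * \<epsilon>)\<^sup>2) = 7921 / 10000 * (real T * x)"
        by (simp add: x_def power2_eq_square)
      \<comment> \<open>This and the next bound give \<open>3 * (real T * x) > 4\<close>, and
        \<open>7921 / 10000 * (4 / 3) > 1\<close> contradicts the disagreement bound.\<close>
      moreover have "2 < real T * x + x"
        using T(2) x(1) by (simp add: field_simps)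
      moreover have "2 * x \<le> real T * x"
        using T(3) x(1) by (intro mult_right_mono) auto
      ultimately show False
        by linarith
    qed
  qed
qed

end
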